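(* There is a constant $c>0$ such that, for all $n\ge 1$, the largest eigenvalue $\lambda_1(M_n)$ of the matrix $M_n$ satisfies $$\lambda_1(M_n)\le 1-\frac{c}{n}.$$
   Context: $M_n$ is the $n\times n$ real symmetric matrix $M_n=C+D$, where $C$ is the circulant matrix having $\frac14$ on the diagonals just above and just below the main diagonal and in the two off-diagonal corners (upper right and lower left), with all other entries $0$, and $D$ is the diagonal matrix with diagonal entries $\frac12\cos\left(\frac{2\pi j}{n}\right)$ for $0\le j\le n-1$. *)

theory Defs
  imports Complex_Main "Jordan_Normal_Form.Spectral_Radius"
begin

(* Rows and columns are indexed by 0, ..., n - 1.  "Off-diagonal corners" is taken
   literally: for n = 1 the only entry lies on the main diagonal, so C_mat 1 is zero
   (and M_mat 1 has the single entry 1/2); for n = 2 the corners are the same two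
   positions as the neighbouring diagonals, and they hold 1/4 (not 1/4 + 1/4). *)

definition C_mat :: "nat \<Rightarrow> real mat" where
  "C_mat n = mat n n (\<lambda>(i, j).
     if i = Suc j \<or> j = Suc i \<or> (i \<noteq> j \<and> (i = 0 \<and> j = n - 1 \<or> i = n - 1 \<and> j = 0))
     then 1 / 4 else 0)"

definition D_mat :: "nat \<Rightarrow> real mat" where
  "D_mat n = mat n n (\<lambda>(i, j).
     if i = j then (1 / 2) * cos (2 * pi * real j / real n) else 0)"

definition M_mat :: "nat \<Rightarrow> real mat" where
  "M_mat n = C_mat n + D_mat n"

(* Max is meaningful when the spectrum over the reals is finite and non-empty,
   as it is for a symmetric matrix of positive dimension. *)
definition largest_eigenvalue :: "real mat \<Rightarrow> real" where
  "largest_eigenvalue A = Max (spectrum A)"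

end

theory Submission
  imports Defs
begin

text \<open>
  Up to scaling, \<open>1 - M\<close> is a discrete harmonic oscillator: with
  \<open>\<theta>\<^sub>j = 2 \<pi> j / n\<close>, the circulant part contributes a second difference (the kinetic
  energy) and the diagonal part the potential \<open>(1 - cos \<theta>\<^sub>j) / 2\<close>, which near its well is of
  order \<open>(j / n)\<^sup>2\<close>.  Kinetic energy and potential cannot both be small; the best compromise is a
  bump of width about \<open>\<surd>n\<close>, for which both are of order \<open>1 / n\<close>.  That is the gap to be proved.

  An upper bound on all eigenvalues follows from a single positive vector.  As \<open>M\<close> has nonnegative
  off-diagonal entries, any \<open>\<phi> > 0\<close> with \<open>M \<phi> \<le> \<mu> \<phi>\<close> entrywise
  forces every real eigenvalue to be at most \<open>\<mu>\<close> (\<open>eigenvalue_le_of_supersolution\<close>, the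
  Collatz--Wielandt bound).  The ground state of the oscillator suggests a Gaussian for
  \<open>\<phi>\<close>; the choice \<open>\<phi>\<^sub>j = exp (b n cos \<theta>\<^sub>j)\<close> looks like \<open>exp (- 2 \<pi>\<^sup>2 b j\<^sup>2 / n)\<close>
  near the well and is periodic, so that the corners of the circulant need no special treatment.
  The lemma \<open>gaussian_weight_supersolution\<close> shows that \<open>b = 1/32\<close> works with
  \<open>\<mu> = 1 - 1 / (32 n)\<close> for all \<open>n \<ge> 2\<close>.  For \<open>n = 1\<close> the weight is of no help, because
  \<open>\<theta>\<close> and its neighbours coincide on the circle, but there the only eigenvalue is \<open>1/2\<close>.

  The largest eigenvalue is a maximum over the real spectrum, so this spectrum also has to be
  nonempty: that is \<open>symmetric_spectrum_nonempty\<close>.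
\<close>

section \<open>Real eigenvalues of symmetric matrices\<close>

lemma eigenvector_row_sum:
  assumes A: "(A :: 'a :: comm_ring_1 mat) \<in> carrier_mat n n"
    and ev: "eigenvector A v k" and i: "i < n"
  shows "(\<Sum>j<n. A $$ (i, j) * v $ j) = k * v $ i"
proof -
  have v: "v \<in> carrier_vec n" and eq: "A *\<^sub>v v = k \<cdot>\<^sub>v v"
    using ev A by (auto simp: eigenvector_def)
  have "(A *\<^sub>v v) $ i = (\<Sum>j<n. A $$ (i, j) * v $ j)"
    using A v i by (auto simp: scalar_prod_def atLeast0LessThan intro!: sum.cong)
  moreover have "(k \<cdot>\<^sub>v v) $ i = k * v $ i" using v i by simp
  ultimately show ?thesis using eq by simp
qed

text \<open>
  The fundamental theorem of algebra gives a complex eigenvalue \<open>k\<close> with eigenvector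
  \<open>a + i b\<close>.  Symmetry, in the form \<open>b \<bullet> A a = a \<bullet> A b\<close>, becomes
  \<open>Im k * (\<bar>a\<bar>\<^sup>2 + \<bar>b\<bar>\<^sup>2) = 0\<close> once the real and imaginary parts of the eigenvector equation
  are inserted.  So \<open>k\<close> is real, and whichever of \<open>a\<close>, \<open>b\<close> is nonzero is a real eigenvector.
\<close>

lemma symmetric_spectrum_nonempty:
  fixes A :: "real mat"
  assumes A: "A \<in> carrier_mat n n" and n: "n > 0"
    and sym: "\<And>i j. i < n \<Longrightarrow> j < n \<Longrightarrow> A $$ (i, j) = A $$ (j, i)"
  shows "spectrum A \<noteq> {}"
proof -
  define B where "B = map_mat complex_of_real A"
  have B: "B \<in> carrier_mat n n" using A by (simp add: B_def)
  obtain k v where ev: "eigenvector B v k"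
    using spectrum_non_empty[OF B n] by (auto simp: spectrum_def eigenvalue_def)
  have v: "v \<in> carrier_vec n" "v \<noteq> 0\<^sub>v n" using ev B by (auto simp: eigenvector_def)
  define a where "a i = Re (v $ i)" for i
  define b where "b i = Im (v $ i)" for i
  have row: "(\<Sum>j<n. of_real (A $$ (i, j)) * v $ j) = k * v $ i" if "i < n" for i
    using eigenvector_row_sum[OF B ev that] A that by (simp add: B_def)
  have rowa: "(\<Sum>j<n. A $$ (i, j) * a j) = Re k * a i - Im k * b i" if "i < n" for i
    using arg_cong[OF row[OF that], of Re] by (simp add: a_def b_def)
  have rowb: "(\<Sum>j<n. A $$ (i, j) * b j) = Re k * b i + Im k * a i" if "i < n" for i
    using arg_cong[OF row[OF that], of Im] by (simp add: a_def b_def)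
  obtain i0 where i0: "i0 < n" "v $ i0 \<noteq> 0"
    using v by (metis carrier_vecD dim_vec eq_vecI index_zero_vec(1) zero_carrier_vec)
  have "(\<Sum>i<n. b i * (\<Sum>j<n. A $$ (i, j) * a j)) = (\<Sum>i<n. \<Sum>j<n. b i * A $$ (i, j) * a j)"
    by (simp add: sum_distrib_left mult.assoc)
  also have "\<dots> = (\<Sum>j<n. \<Sum>i<n. b i * A $$ (i, j) * a j)" by (rule sum.swap)
  also have "\<dots> = (\<Sum>j<n. a j * (\<Sum>i<n. A $$ (j, i) * b i))"
    using sym by (auto simp: sum_distrib_left mult_ac intro!: sum.cong)
  finally have "(\<Sum>i<n. b i * (Re k * a i - Im k * b i)) = (\<Sum>i<n. a i * (Re k * b i + Im k * a i))"
    by (simp add: rowa rowb)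
  then have "(\<Sum>i<n. a i * (Re k * b i + Im k * a i) - b i * (Re k * a i - Im k * b i)) = 0"
    by (simp add: sum_subtractf)
  moreover have "a i * (Re k * b i + Im k * a i) - b i * (Re k * a i - Im k * b i)
      = Im k * ((a i)\<^sup>2 + (b i)\<^sup>2)" for i
    by (simp add: algebra_simps power2_eq_square)
  ultimately have "Im k * (\<Sum>i<n. (a i)\<^sup>2 + (b i)\<^sup>2) = 0"
    by (simp only: sum_distrib_left)
  moreover have "(\<Sum>i<n. (a i)\<^sup>2 + (b i)\<^sup>2) > 0"
  proof (rule sum_pos2[of _ i0])
    show "0 < (a i0)\<^sup>2 + (b i0)\<^sup>2"
      using i0 by (simp add: a_def b_def complex_eq_iff sum_power2_gt_zero_iff)
  qed (use i0 in auto)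
  ultimately have Im: "Im k = 0" by simp
  have real_ev: "eigenvalue A (Re k)"
    if row': "\<And>i. i < n \<Longrightarrow> (\<Sum>j<n. A $$ (i, j) * x j) = Re k * x i" and nz: "x i0 \<noteq> 0" for x
  proof -
    have "A *\<^sub>v vec n x = Re k \<cdot>\<^sub>v vec n x"
      by (rule eq_vecI) (use A row' in \<open>auto simp: scalar_prod_def atLeast0LessThan\<close>)
    moreover have "vec n x \<noteq> 0\<^sub>v n"
      using nz i0 by (metis index_vec index_zero_vec(1))
    ultimately have "eigenvector A (vec n x) (Re k)" using A by (simp add: eigenvector_def)
    then show ?thesis by (auto simp: eigenvalue_def)
  qed
  have "a i0 \<noteq> 0 \<or> b i0 \<noteq> 0" using i0 by (simp add: a_def b_def complex_eq_iff)
  then have "eigenvalue A (Re k)"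
    using real_ev[of a] real_ev[of b] rowa rowb Im by auto
  then show ?thesis by (auto simp: spectrum_def)
qed

section \<open>Positive supersolutions bound eigenvalues\<close>

text \<open>
  Scale \<open>\<phi>\<close> until it just dominates \<open>\<bar>v\<bar>\<close> for an eigenvector \<open>v\<close>, and compare the
  eigenvector equation with the hypothesis on \<open>\<phi>\<close> in a row \<open>i\<close> where the two touch.  Off the diagonal
  the comparison uses nonnegativity of the entries; on the diagonal it is an equality, because
  there the two vectors agree in absolute value.
\<close>

lemma eigenvalue_le_of_supersolution:
  fixes A :: "real mat"
  assumes A: "A \<in> carrier_mat n n"
    and nonneg: "\<And>i j. i < n \<Longrightarrow> j < n \<Longrightarrow> i \<noteq> j \<Longrightarrow> A $$ (i, j) \<ge> 0"
    and pos: "\<And>i. i < n \<Longrightarrow> \<phi> i > 0"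
    and super: "\<And>i. i < n \<Longrightarrow> (\<Sum>j<n. A $$ (i, j) * \<phi> j) \<le> \<mu> * \<phi> i"
    and ev: "eigenvalue A k"
  shows "k \<le> \<mu>"
proof -
  obtain v where v: "eigenvector A v k" using ev by (auto simp: eigenvalue_def)
  have v': "v \<in> carrier_vec n" "v \<noteq> 0\<^sub>v n" using v A by (auto simp: eigenvector_def)
  obtain i0 where i0: "i0 < n" "v $ i0 \<noteq> 0"
    using v' by (metis carrier_vecD dim_vec eq_vecI index_zero_vec(1) zero_carrier_vec)
  define r where "r i = \<bar>v $ i\<bar> / \<phi> i" for i
  define m where "m = Max (r ` {..<n})"
  have "m \<in> r ` {..<n}" unfolding m_def using i0 by (intro Max_in) auto
  then obtain i where i: "i < n" "r i = m" by auto
  have le_m: "r j \<le> m" if "j < n" for j unfolding m_def using that by (intro Max_ge) auto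
  have "r i0 > 0" using i0 pos by (simp add: r_def)
  then have m_pos: "m > 0" using le_m[OF i0(1)] by simp
  have abs_le: "\<bar>v $ j\<bar> \<le> m * \<phi> j" if "j < n" for j
    using le_m[OF that] pos[OF that] by (simp add: r_def divide_le_eq)
  have abs_eq: "\<bar>v $ i\<bar> = m * \<phi> i"
    using i(2) pos[OF i(1)] by (auto simp: r_def divide_eq_eq)
  define s where "s = sgn (v $ i)"
  have s: "\<bar>s\<bar> \<le> 1" "s * v $ i = \<bar>v $ i\<bar>" by (auto simp: s_def sgn_if)
  have "k * \<bar>v $ i\<bar> = s * (k * v $ i)" using s(2) by (simp add: algebra_simps)
  also have "\<dots> = (\<Sum>j<n. A $$ (i, j) * (s * v $ j))"
    unfolding eigenvector_row_sum[OF A v i(1), symmetric] by (simp add: sum_distrib_left mult_ac)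
  also have "\<dots> \<le> (\<Sum>j<n. A $$ (i, j) * (m * \<phi> j))"
  proof (rule sum_mono)
    fix j assume "j \<in> {..<n}"
    then have j: "j < n" by simp
    show "A $$ (i, j) * (s * v $ j) \<le> A $$ (i, j) * (m * \<phi> j)"
    proof (cases "j = i")
      case True
      then show ?thesis using s(2) abs_eq by simp
    next
      case False
      have "s * v $ j \<le> \<bar>s\<bar> * \<bar>v $ j\<bar>" by (metis abs_ge_self abs_mult)
      also have "\<dots> \<le> 1 * \<bar>v $ j\<bar>" by (rule mult_right_mono) (use s in auto)
      finally have "s * v $ j \<le> m * \<phi> j" using abs_le[OF j] by simp
      then show ?thesis using nonneg[OF i(1) j] False by (auto intro: mult_left_mono)
    qed
  qed
  also have "\<dots> = m * (\<Sum>j<n. A $$ (i, j) * \<phi> j)" by (simp add: sum_distrib_left mult_ac)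
  also have "\<dots> \<le> m * (\<mu> * \<phi> i)" using super[OF i(1)] m_pos by (simp add: mult_left_mono)
  also have "\<dots> = \<mu> * \<bar>v $ i\<bar>" using abs_eq by simp
  finally have "k * \<bar>v $ i\<bar> \<le> \<mu> * \<bar>v $ i\<bar>" .
  moreover have "\<bar>v $ i\<bar> > 0" using abs_eq m_pos pos[OF i(1)] by simp
  ultimately show ?thesis by simp
qed

section \<open>A Gaussian weight on the circle\<close>

lemma exp_le_quadratic:
  fixes x :: real
  assumes "\<bar>x\<bar> \<le> 1"
  shows "exp x \<le> 1 + x + x\<^sup>2"
proof (cases "x \<ge> 0")
  case True
  then show ?thesis using exp_bound assms by auto
next
  case False
  define z where "z = - x"
  have z: "0 \<le> z" using False by (simp add: z_def)
  have "1 + z + z\<^sup>2 / 2 \<le> exp z" using exp_lower_Taylor_quadratic[OF z] by simp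
  moreover have "1 \<le> (1 - z + z\<^sup>2) * (1 + z + z\<^sup>2 / 2)"
  proof -
    have "(1 - z + z\<^sup>2) * (1 + z + z\<^sup>2 / 2) = 1 + (z\<^sup>2 + z ^ 3 + z ^ 4) / 2"
      by (simp add: field_simps power2_eq_square power3_eq_cube power4_eq_xxxx)
    then show ?thesis using z by simp
  qed
  moreover have "1 - z + z\<^sup>2 \<ge> 0"
    using assms by (simp add: z_def)
  ultimately have "1 \<le> (1 - z + z\<^sup>2) * exp z"
    by (meson mult_left_mono order_trans)
  then show ?thesis by (simp add: z_def exp_minus field_simps)
qed

lemma abs_sin_of_nat_mult_le:
  fixes x :: real
  shows "\<bar>sin (real n * x)\<bar> \<le> real n * \<bar>sin x\<bar>"
proof (induction n)
  case (Suc n)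
  have "\<bar>sin (real (Suc n) * x)\<bar> = \<bar>sin (real n * x) * cos x + cos (real n * x) * sin x\<bar>"
    by (simp only: of_nat_Suc distrib_right mult_1_left sin_add) (simp add: ac_simps)
  also have "\<dots> \<le> \<bar>sin (real n * x)\<bar> * \<bar>cos x\<bar> + \<bar>cos (real n * x)\<bar> * \<bar>sin x\<bar>"
    by (metis abs_mult abs_triangle_ineq)
  also have "\<dots> \<le> \<bar>sin (real n * x)\<bar> * 1 + 1 * \<bar>sin x\<bar>"
    by (intro add_mono mult_left_mono mult_right_mono) auto
  finally show ?case using Suc by (simp add: distrib_right)
qed simp

text \<open>
  The estimate \<open>\<bar>sin (n \<alpha>)\<bar> \<le> n \<bar>sin \<alpha>\<bar>\<close> at \<open>\<alpha> = \<pi> / (2 n)\<close>, where the left-hand side is 1,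
  bounds \<open>sin \<alpha>\<close> below by \<open>1 / n\<close>; two duplication formulas carry this over to the
  angle \<open>4 \<alpha> = 2 \<pi> / n\<close>.
\<close>

lemma one_minus_cos_lower:
  assumes n: "n \<ge> 2"
  shows "4 / (real n)\<^sup>2 \<le> 1 - cos (2 * pi / real n)"
proof -
  define \<alpha> where "\<alpha> = pi / (2 * real n)"
  have \<alpha>: "0 \<le> \<alpha>" "\<alpha> \<le> pi / 4" using n by (auto simp: \<alpha>_def field_simps)
  have "real n * \<alpha> = pi / 2" using n by (simp add: \<alpha>_def)
  then have "sin (real n * \<alpha>) = 1" by (simp only: sin_pi_half)
  then have "1 \<le> real n * \<bar>sin \<alpha>\<bar>"
    using abs_sin_of_nat_mult_le[of n \<alpha>] by simp
  then have "1\<^sup>2 \<le> (real n * \<bar>sin \<alpha>\<bar>)\<^sup>2" by (intro power_mono) auto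
  then have s: "1 / (real n)\<^sup>2 \<le> (sin \<alpha>)\<^sup>2"
    using n by (simp add: power_mult_distrib field_simps)
  have "cos (pi / 4) \<le> cos \<alpha>" using \<alpha> by (intro cos_monotone_0_pi_le) auto
  then have "(cos (pi / 4))\<^sup>2 \<le> (cos \<alpha>)\<^sup>2" by (intro power_mono) (auto simp: cos_45)
  then have c: "1 / 2 \<le> (cos \<alpha>)\<^sup>2" by (simp add: cos_45 power_divide)
  have "1 / (real n)\<^sup>2 * (1 / 2) \<le> (sin \<alpha>)\<^sup>2 * (cos \<alpha>)\<^sup>2"
    using s c by (intro mult_mono) auto
  moreover have "1 - cos (2 * pi / real n) = 8 * ((sin \<alpha>)\<^sup>2 * (cos \<alpha>)\<^sup>2)"
  proof -
    have "2 * pi / real n = 2 * (2 * \<alpha>)" by (simp add: \<alpha>_def)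
    then have "1 - cos (2 * pi / real n) = 2 * (sin (2 * \<alpha>))\<^sup>2"
      using cos_double_sin[of "2 * \<alpha>"] by (simp only:)
    then show ?thesis by (simp add: sin_double power_mult_distrib)
  qed
  ultimately show ?thesis by simp
qed

lemma one_minus_cos_upper:
  assumes n: "n \<ge> 1"
  shows "1 - cos (2 * pi / real n) \<le> 32 / (real n)\<^sup>2"
proof -
  have "\<bar>sin (pi / real n)\<bar> \<le> 4 / real n"
  proof -
    have "\<bar>sin (pi / real n)\<bar> \<le> pi / real n" using abs_sin_x_le_abs_x[of "pi / real n"] by simp
    also have "\<dots> \<le> 4 / real n" using pi_less_4 by (intro divide_right_mono) auto
    finally show ?thesis .
  qed
  then have "\<bar>sin (pi / real n)\<bar>\<^sup>2 \<le> (4 / real n)\<^sup>2" by (intro power_mono) auto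
  then show ?thesis using cos_double_sin[of "pi / real n"] by (simp add: power_divide)
qed

text \<open>
  With \<open>C = cos \<theta>\<close>, the ratios \<open>w (\<theta> \<plusminus> h) / w \<theta>\<close> are \<open>exp (- p C \<mp> t)\<close>, where
  \<open>p\<close> is of order \<open>1 / n\<close> and \<open>t\<close> is a small multiple of \<open>sin \<theta>\<close>.  In their average the
  linear terms in \<open>t\<close> cancel.  What is left of \<open>t\<close> is quadratic and hence absorbed by a
  part of the potential \<open>1 - C\<close>, since \<open>sin\<^sup>2 \<theta> \<le> 2 (1 - C)\<close>.  Near the well the gain is
  \<open>p C\<close>, of the desired order \<open>1 / n\<close>; away from the well, where \<open>p C\<close> is small or
  negative, the rest of the potential takes over.
\<close>

lemma gaussian_weight_supersolution:
  fixes n :: nat and \<theta> :: real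
  defines "h \<equiv> 2 * pi / real n" and "w \<equiv> \<lambda>x::real. exp (real n / 32 * cos x)"
  assumes n: "n \<ge> 2"
  shows "(w (\<theta> + h) + w (\<theta> - h)) / 4 + cos \<theta> / 2 * w \<theta> \<le> (1 - 1 / 32 / real n) * w \<theta>"
proof -
  define C where "C = cos \<theta>"
  define p where "p = real n / 32 * (1 - cos h)"
  define t where "t = real n / 32 * (sin \<theta> * sin h)"
  have C: "\<bar>C\<bar> \<le> 1" by (simp add: C_def)
  \<comment> \<open>The factor \<open>1/32\<close> in \<open>w\<close> is what turns \<open>1 - cos h \<le> 32 / n\<^sup>2\<close> into \<open>p \<le> 1 / n\<close>.\<close>
  have p_low: "1 / (8 * real n) \<le> p"
  proof -
    have "real n / 32 * (4 / (real n)\<^sup>2) \<le> p"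
      unfolding p_def h_def using one_minus_cos_lower[OF n] by (intro mult_left_mono) auto
    moreover have "real n / 32 * (4 / (real n)\<^sup>2) = 1 / (8 * real n)"
      using n by (simp add: power2_eq_square)
    ultimately show ?thesis by simp
  qed
  have p_up: "p \<le> 1 / 2"
  proof -
    have "p \<le> real n / 32 * (32 / (real n)\<^sup>2)"
      unfolding p_def h_def using one_minus_cos_upper[of n] n by (intro mult_left_mono) auto
    also have "\<dots> = 1 / real n" by (simp add: power2_eq_square)
    also have "\<dots> \<le> 1 / 2" using n by (simp add: field_simps)
    finally show ?thesis .
  qed
  have p_pos: "p > 0" using p_low n by (smt (verit) divide_pos_pos of_nat_0_less_iff pos2 less_le_trans)
  have t: "\<bar>t\<bar> \<le> \<bar>sin \<theta>\<bar> / 4"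
  proof -
    have "\<bar>sin h\<bar> \<le> 8 / real n"
    proof -
      have "\<bar>sin h\<bar> \<le> 2 * pi / real n" using abs_sin_x_le_abs_x[of h] by (simp add: h_def)
      also have "\<dots> \<le> 8 / real n" using pi_less_4 by (intro divide_right_mono) auto
      finally show ?thesis .
    qed
    then have "\<bar>t\<bar> \<le> real n / 32 * (\<bar>sin \<theta>\<bar> * (8 / real n))"
      unfolding t_def abs_mult by (intro mult_mono) auto
    also have "\<dots> = \<bar>sin \<theta>\<bar> / 4" using n by simp
    finally show ?thesis .
  qed
  have t_sq: "t\<^sup>2 \<le> (1 - C) / 4"
  proof -
    have "\<bar>t\<bar>\<^sup>2 \<le> (\<bar>sin \<theta>\<bar> / 4)\<^sup>2" using t by (intro power_mono) auto
    moreover have "(sin \<theta>)\<^sup>2 = (1 - C) * (1 + C)"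
      by (simp add: C_def sin_squared_eq algebra_simps power2_eq_square)
    ultimately have "t\<^sup>2 \<le> (1 - C) * (1 + C) / 16" by (simp add: power_divide)
    also have "\<dots> \<le> (1 - C) * 2 / 16" using C by (intro divide_right_mono mult_left_mono) auto
    finally show ?thesis using C by simp
  qed
  have pC: "\<bar>p * C\<bar> \<le> 1 / 2"
    using mult_mono[of "\<bar>p\<bar>" "1/2" "\<bar>C\<bar>" 1] p_up p_pos C by (simp add: abs_mult)
  have "\<bar>sin \<theta>\<bar> \<le> 1" by simp
  then have t4: "\<bar>t\<bar> \<le> 1 / 4" using t by linarith
  have wp: "w (\<theta> + h) = w \<theta> * exp (- p * C - t)"
    by (simp add: w_def p_def t_def C_def cos_add flip: exp_add) (simp add: algebra_simps)
  have wm: "w (\<theta> - h) = w \<theta> * exp (- p * C + t)"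
    by (simp add: w_def p_def t_def C_def cos_diff flip: exp_add) (simp add: algebra_simps)
  have ep: "exp (- p * C - t) \<le> 1 + (- p * C - t) + (- p * C - t)\<^sup>2"
    using pC t4 by (intro exp_le_quadratic) linarith
  have em: "exp (- p * C + t) \<le> 1 + (- p * C + t) + (- p * C + t)\<^sup>2"
    using pC t4 by (intro exp_le_quadratic) linarith
  have sq: "(- p * C - t)\<^sup>2 + (- p * C + t)\<^sup>2 = 2 * (p * C)\<^sup>2 + 2 * t\<^sup>2"
    by (simp add: power2_eq_square algebra_simps)
  \<comment> \<open>One quarter of \<open>1 - C\<close> is reserved for \<open>t\<^sup>2\<close>; the remaining three quarters have
    to make up for the loss of \<open>p C\<close> when \<open>C < 1\<close>.\<close>
  have key: "p / 2 \<le> 3 / 4 * (1 - C) + p * C - (p * C)\<^sup>2"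
  proof (cases "C \<ge> 0")
    case True
    have "(p * C)\<^sup>2 \<le> (1 / 2) * (p * C)"
      unfolding power2_eq_square using pC True p_pos by (intro mult_right_mono) auto
    moreover have "p * (1 - C) \<le> 1 / 2 * (1 - C)" using p_up C by (intro mult_right_mono) auto
    moreover have "p * (1 - C) = p - p * C" by (simp add: right_diff_distrib)
    moreover have "C \<le> 1" using C by simp
    ultimately show ?thesis by argo
  next
    case False
    have "p * (- C) \<le> 1 / 2 * (- C)" using p_up False by (intro mult_right_mono) auto
    then have "C / 2 \<le> p * C" by simp
    moreover have "(p * C)\<^sup>2 \<le> - (p * C) / 2"
    proof -
      have "(- (p * C)) * (- (p * C)) \<le> 1 / 2 * (- (p * C))"
        using pC False p_pos by (intro mult_right_mono) (auto simp: mult_le_0_iff)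
      then show ?thesis by (simp add: power2_eq_square)
    qed
    moreover have "C < 0" using False by simp
    ultimately show ?thesis using p_up by argo
  qed
  have "(exp (- p * C - t) + exp (- p * C + t)) / 4 + C / 2 \<le> 1 - p / 4"
    using ep em sq key t_sq by (simp add: field_simps)
  also have "\<dots> \<le> 1 - 1 / 32 / real n" using p_low by simp
  finally have "((exp (- p * C - t) + exp (- p * C + t)) / 4 + C / 2) * w \<theta>
      \<le> (1 - 1 / 32 / real n) * w \<theta>"
    by (rule mult_right_mono) (simp add: w_def)
  then show ?thesis unfolding wp wm C_def[symmetric] by (simp add: algebra_simps)
qed

section \<open>The gap for the circulant matrix with cosine potential\<close>

text \<open>
  Sampled at the \<open>n\<close>-th roots of unity, a function on the circle has its
  cyclic neighbours at angles \<open>\<plusminus> 2 \<pi> / n\<close>.  It is an inequality because for \<open>n \<le> 2\<close> the two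
  neighbours coincide and the matrix counts them once (\<open>n = 2\<close>) or not at all (\<open>n = 1\<close>).
\<close>

lemma C_mat_row_le:
  fixes g :: "real \<Rightarrow> real"
  assumes j: "j < n" and g0: "\<And>x. g x \<ge> 0" and per: "\<And>x. g (x + 2 * pi) = g x"
  shows "(\<Sum>i<n. C_mat n $$ (j, i) * g (2 * pi * real i / real n))
    \<le> (g (2 * pi * real j / real n + 2 * pi / real n)
        + g (2 * pi * real j / real n - 2 * pi / real n)) / 4"
proof -
  define s where "s = (if j = n - 1 then 0 else j + 1)"
  define p where "p = (if j = 0 then n - 1 else j - 1)"
  have sp: "s < n" "p < n" using j by (auto simp: s_def p_def)
  let ?f = "\<lambda>i. g (2 * pi * real i / real n)"
  have "(\<Sum>i<n. C_mat n $$ (j, i) * ?f i)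
      \<le> (\<Sum>i<n. (if i = s then ?f i / 4 else 0) + (if i = p then ?f i / 4 else 0))"
    using j g0 by (intro sum_mono) (auto simp: C_mat_def s_def p_def)
  also have "\<dots> = (?f s + ?f p) / 4"
    using sp by (simp add: sum.distrib add_divide_distrib)
  also have "?f s = g (2 * pi * real j / real n + 2 * pi / real n)"
  proof (cases "j = n - 1")
    case True
    have "2 * pi * real j / real n + 2 * pi / real n = 0 + 2 * pi"
      using True j by (simp add: of_nat_diff field_simps)
    then show ?thesis using True per[of 0] by (simp add: s_def)
  qed (simp add: s_def add_divide_distrib distrib_left add.commute)
  also have "?f p = g (2 * pi * real j / real n - 2 * pi / real n)"
  proof (cases "j = 0")
    case True
    have "2 * pi * real p / real n = (2 * pi * real j / real n - 2 * pi / real n) + 2 * pi"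
      using True j by (simp add: p_def of_nat_diff field_simps)
    then show ?thesis by (simp only: per)
  qed (simp add: p_def of_nat_diff diff_divide_distrib right_diff_distrib)
  finally show ?thesis .
qed

lemma M_mat_carrier: "M_mat n \<in> carrier_mat n n"
  by (simp add: M_mat_def C_mat_def D_mat_def)

lemma M_mat_row_sum:
  assumes "j < n"
  shows "(\<Sum>i<n. M_mat n $$ (j, i) * f i)
    = (\<Sum>i<n. C_mat n $$ (j, i) * f i) + cos (2 * pi * real j / real n) / 2 * f j"
proof -
  have "(\<Sum>i<n. M_mat n $$ (j, i) * f i) = (\<Sum>i<n. C_mat n $$ (j, i) * f i
      + (if i = j then cos (2 * pi * real j / real n) / 2 * f j else 0))"
    using assms by (intro sum.cong) (auto simp: M_mat_def C_mat_def D_mat_def distrib_right)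
  then show ?thesis using assms by (simp add: sum.distrib)
qed

lemma eigenvalue_M_mat_le:
  assumes n: "n \<ge> 1" and ev: "eigenvalue (M_mat n) k"
  shows "k \<le> 1 - 1 / 32 / real n"
proof (cases "n = 1")
  case True
  have "k \<le> 1 / 2"
    by (rule eigenvalue_le_of_supersolution[where \<phi> = "\<lambda>_. 1", OF M_mat_carrier _ _ _ ev])
      (use True in \<open>auto simp: M_mat_def C_mat_def D_mat_def\<close>)
  then show ?thesis using True by simp
next
  case False
  then have n2: "n \<ge> 2" using n by simp
  define w where "w x = exp (real n / 32 * cos x)" for x :: real
  show ?thesis
  proof (rule eigenvalue_le_of_supersolution[OF M_mat_carrier _ _ _ ev])
    fix j assume j: "j < n"
    have "(\<Sum>i<n. C_mat n $$ (j, i) * w (2 * pi * real i / real n))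
        \<le> (w (2 * pi * real j / real n + 2 * pi / real n)
            + w (2 * pi * real j / real n - 2 * pi / real n)) / 4"
      using j by (rule C_mat_row_le) (simp_all add: w_def)
    then show "(\<Sum>i<n. M_mat n $$ (j, i) * w (2 * pi * real i / real n))
        \<le> (1 - 1 / 32 / real n) * w (2 * pi * real j / real n)"
      using gaussian_weight_supersolution[OF n2, of "2 * pi * real j / real n"]
      unfolding M_mat_row_sum[OF j] w_def by linarith
  qed (auto simp: w_def M_mat_def C_mat_def D_mat_def)
qed

theorem theorem3:
  shows "\<exists>c::real. c > 0 \<and>
           (\<forall>n::nat. n \<ge> 1 \<longrightarrow> largest_eigenvalue (M_mat n) \<le> 1 - c / real n)"
proof (intro exI[of _ "1 / 32"] conjI allI impI)
  fix n :: nat assume n: "n \<ge> 1"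
  have "spectrum (M_mat n) \<noteq> {}"
    by (rule symmetric_spectrum_nonempty[OF M_mat_carrier])
      (use n in \<open>auto simp: M_mat_def C_mat_def D_mat_def\<close>)
  then have "Max (spectrum (M_mat n)) \<in> spectrum (M_mat n)"
    using card_finite_spectrum(1)[OF M_mat_carrier] by (rule Max_in[rotated])
  then show "largest_eigenvalue (M_mat n) \<le> 1 - 1 / 32 / real n"
    using eigenvalue_M_mat_le[OF n] by (simp add: largest_eigenvalue_def spectrum_def)
qed simp

end
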